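(* Let $G=G^{(0)}$ be a signed graph with canonical marking, having $n_+$ positively marked and $n_-$ negatively marked nodes, $n=n_++n_-$, and let $G^{(m)}$ be the signed corona graphs generated by $G$. Let $1\le i\le m$ and let $v$ be a node that appears at step $i$, i.e. $v$ is a node of a copy of $G$ attached to a node $u$ of $G^{(i-1)}$ in forming $G^{(i)}=G^{(i-1)}\circ G$. Let $d_0^\pm(v)$ and $\mu_0(v)$ be the positive/negative degree and canonical marking of $v$ as a node of $G$, and $\mu(u)$ the canonical marking of $u$ in $G^{(i-1)}$. Then the positive and negative degrees $d^+(v),d^-(v)$ of $v$ in $G^{(m)}$ are: (1) $n_+,n_-$ both odd. If $m,i$ have the same parity: for $(\mu(u),\mu_0(v))=(+,+)$ or $(-,-)$, $d^+(v)=d_0^+(v)+1+\frac{m-i}{2}n$, $d^-(v)=d_0^-(v)+\frac{m-i}{2}n$; for $(+,-)$ or $(-,+)$, $d^+(v)=d_0^+(v)+\frac{m-i}{2}n$, $d^-(v)=d_0^-(v)+1+\frac{m-i}{2}n$. If $m,i$ have different parity: for $(+,+)$, $d^+=d_0^++1+\frac{m-i+1}{2}n_++\frac{m-i-1}{2}n_-$, $d^-=d_0^-+\frac{m-i+1}{2}n_-+\frac{m-i-1}{2}n_+$; for $(+,-)$, $d^+=d_0^++\frac{m-i+1}{2}n_++\frac{m-i-1}{2}n_-$, $d^-=d_0^-+1+\frac{m-i+1}{2}n_-+\frac{m-i-1}{2}n_+$; for $(-,+)$, $d^+=d_0^++\frac{m-i+1}{2}n_-+\frac{m-i-1}{2}n_+$,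 $d^-=d_0^-+1+\frac{m-i+1}{2}n_++\frac{m-i-1}{2}n_-$; for $(-,-)$, $d^+=d_0^++1+\frac{m-i+1}{2}n_-+\frac{m-i-1}{2}n_+$, $d^-=d_0^-+\frac{m-i+1}{2}n_++\frac{m-i-1}{2}n_-$. (2) $n_+$ even, $n_-$ odd. For $(+,+)$: if $m>i$, $d^+=d_0^++1+n_++(m-i-1)n_-$, $d^-=d_0^-+n_-+(m-i-1)n_+$; if $m=i$, $d^+=d_0^++1$, $d^-=d_0^-$. For $(+,-)$: if $m>i$, $d^+=d_0^++n_++(m-i-1)n_-$, $d^-=d_0^-+1+n_-+(m-i-1)n_+$; if $m=i$, $d^+=d_0^+$, $d^-=d_0^-+1$. For $(-,+)$: $d^+=d_0^++(m-i)n_-$, $d^-=d_0^-+1+(m-i)n_+$. For $(-,-)$: $d^+=d_0^++1+(m-i)n_-$, $d^-=d_0^-+(m-i)n_+$. (3) $n_+,n_-$ both even. For $(+,+)$: $d^+=d_0^++1+(m-i)n_+$, $d^-=d_0^-+(m-i)n_-$. For $(+,-)$: $d^+=d_0^++(m-i)n_+$, $d^-=d_0^-+1+(m-i)n_-$. For $(-,+)$: $d^+=d_0^++(m-i)n_-$, $d^-=d_0^-+1+(m-i)n_+$. For $(-,-)$: $d^+=d_0^++1+(m-i)n_-$, $d^-=d_0^-+(m-i)n_+$. (4) $n_+$ odd, $n_-$ even. For $(+,+)$: $d^+=d_0^++1+(m-i)n_+$, $d^-=d_0^-+(m-i)n_-$. For $(+,-)$: $d^+=d_0^++(m-i)n_+$,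 $d^-=d_0^-+1+(m-i)n_-$. For $(-,+)$: if $m>i$, $d^+=d_0^++n_-+(m-i-1)n_+$, $d^-=d_0^-+1+n_++(m-i-1)n_-$; if $m=i$, $d^+=d_0^+$, $d^-=d_0^-+1$. For $(-,-)$: if $m>i$, $d^+=d_0^++1+n_-+(m-i-1)n_+$, $d^-=d_0^-+n_++(m-i-1)n_-$; if $m=i$, $d^+=d_0^++1$, $d^-=d_0^-$. (Here $d^\pm$ abbreviates $d^\pm(v)$ and $d_0^\pm$ abbreviates $d_0^\pm(v)$.)
   Context: A signed graph has edges signed $+$ or $-$; $d^\pm(v)$ are the numbers of positive/negative edges at $v$. The canonical marking of a node $v$ is $\mu(v)=\prod_{e\ni v}\sigma(e)$, the product of the signs of all edges incident to $v$ (so $\mu(v)=+$ iff $d^-(v)$ is even). Corona product of signed graphs $H_1$ (nodes $u_1,\dots,u_N$) and $H_2$, each canonically marked: take one copy of $H_1$ and $N$ copies of $H_2$ and join $u_i$ to every node of the $i$-th copy of $H_2$, the edge from $u_i$ to the copy of $w$ having sign $\mu_{H_1}(u_i)\mu_{H_2}(w)$. Signed corona graphs generated by the seed graph $G$: $G^{(0)}=G$ and $G^{(m)}=G^{(m-1)}\circ G$ for $m\ge1$, where at each step $G^{(m-1)}$ carries its own canonical marking (as a signed graph) and $G$ its canonical marking. Nodes of $G^{(i)}$ are regarded as nodes of every $G^{(m)}$, $m\ge i$. *)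

theory Defs
  imports Main
begin

text \<open>Signed graphs are finite and simple; the signs \<open>+\<close> and \<open>-\<close> are the integers \<open>1\<close> and \<open>-1\<close>.
  Only the values of \<open>sgn_of\<close> on \<open>edges\<close> are meaningful.\<close>

record 'v sgraph =
  nodes :: "'v set"
  edges :: "'v set set"
  sgn_of :: "'v set \<Rightarrow> int"

definition signed_graph :: "'v sgraph \<Rightarrow> bool" where
  "signed_graph H \<longleftrightarrow>
     finite (nodes H) \<and>
     (\<forall>e \<in> edges H. e \<subseteq> nodes H \<and> card e = 2) \<and>
     (\<forall>e \<in> edges H. sgn_of H e = 1 \<or> sgn_of H e = -1)"

definition pos_degree :: "'v sgraph \<Rightarrow> 'v \<Rightarrow> nat" where
  "pos_degree H v = card {e \<in> edges H. v \<in> e \<and> sgn_of H e = 1}"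

definition neg_degree :: "'v sgraph \<Rightarrow> 'v \<Rightarrow> nat" where
  "neg_degree H v = card {e \<in> edges H. v \<in> e \<and> sgn_of H e = -1}"

definition marking :: "'v sgraph \<Rightarrow> 'v \<Rightarrow> int" where
  "marking H v = (\<Prod>e \<in> {e \<in> edges H. v \<in> e}. sgn_of H e)"

text \<open>In the corona product, \<open>Inl u\<close> is the node \<open>u\<close> of \<open>H1\<close> and \<open>Inr (u, w)\<close> is the node \<open>w\<close> in the
  copy of \<open>H2\<close> that is attached to \<open>u\<close>. An edge inside \<open>H1\<close> or inside a copy of \<open>H2\<close> keeps its sign;
  the sign of an edge joining the two is the product of the canonical marks of its ends. See the
  lemmas \<open>sgn_of_corona_left\<close>, \<open>sgn_of_corona_copy\<close> and \<open>sgn_of_corona_join\<close>.\<close>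

definition corona :: "'b sgraph \<Rightarrow> 'a sgraph \<Rightarrow> ('b + 'b \<times> 'a) sgraph" where
  "corona H1 H2 =
    \<lparr> nodes = Inl ` nodes H1 \<union> {Inr (u, w) | u w. u \<in> nodes H1 \<and> w \<in> nodes H2},
      edges = {Inl ` e | e. e \<in> edges H1}
        \<union> {(\<lambda>w. Inr (u, w)) ` e | u e. u \<in> nodes H1 \<and> e \<in> edges H2}
        \<union> {{Inl u, Inr (u, w)} | u w. u \<in> nodes H1 \<and> w \<in> nodes H2},
      sgn_of = (\<lambda>e.
        if e \<subseteq> range Inl then sgn_of H1 {x. Inl x \<in> e}
        else if e \<subseteq> range Inr then sgn_of H2 {w. \<exists>u. Inr (u, w) \<in> e}
        else (\<Prod>x \<in> e. case x of Inl u \<Rightarrow> marking H1 u | Inr (u, w) \<Rightarrow> marking H2 w)) \<rparr>"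

lemma sgn_of_corona_left:
  fixes H1 :: "'b sgraph" and H2 :: "'a sgraph"
  shows "sgn_of (corona H1 H2) (Inl ` e) = sgn_of H1 e"
proof -
  let ?e = "Inl ` e :: ('b + 'b \<times> 'a) set"
  have "{x. Inl x \<in> ?e} = e" "?e \<subseteq> range Inl" by auto
  then show ?thesis by (simp add: corona_def)
qed

lemma sgn_of_corona_copy:
  fixes H1 :: "'b sgraph" and H2 :: "'a sgraph"
  assumes "e \<noteq> {}"
  shows "sgn_of (corona H1 H2) ((\<lambda>w. Inr (u, w)) ` e) = sgn_of H2 e"
proof -
  let ?e = "(\<lambda>w. Inr (u, w)) ` e :: ('b + 'b \<times> 'a) set"
  have "{w. \<exists>u'. Inr (u', w) \<in> ?e} = e" "\<not> ?e \<subseteq> range Inl" "?e \<subseteq> range Inr"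
    using assms by auto
  then show ?thesis by (simp add: corona_def)
qed

lemma sgn_of_corona_join:
  "sgn_of (corona H1 H2) {Inl u, Inr (u, w)} = marking H1 u * marking H2 w"
  by (auto simp: corona_def)

text \<open>Renaming the nodes along a map that is injective on them.\<close>

definition relabel :: "('v \<Rightarrow> 'w) \<Rightarrow> 'v sgraph \<Rightarrow> 'w sgraph" where
  "relabel f H =
    \<lparr> nodes = f ` nodes H,
      edges = (\<lambda>e. f ` e) ` edges H,
      sgn_of = (\<lambda>e. sgn_of H {x \<in> nodes H. f x \<in> e}) \<rparr>"

lemma sgn_of_relabel:
  assumes "inj_on f (nodes H)" "e \<subseteq> nodes H"
  shows "sgn_of (relabel f H) (f ` e) = sgn_of H e"
proof -
  have "{x \<in> nodes H. f x \<in> f ` e} = e"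
    using assms by (auto dest: inj_onD)
  then show ?thesis by (simp add: relabel_def)
qed

text \<open>All the graphs generated by a seed graph live on one node type, so that a node keeps its name
  from the step at which it appears onwards. \<open>Copy k u w\<close> is the node \<open>w\<close> in the copy of the seed
  graph that is attached to \<open>u\<close> at step \<open>k\<close>; the step has to be recorded because every later step
  attaches a further copy to the same \<open>u\<close>.\<close>

datatype 'a cnode = Seed 'a | Copy nat "'a cnode" 'a

fun cnode_of :: "nat \<Rightarrow> 'a cnode + 'a cnode \<times> 'a \<Rightarrow> 'a cnode" where
  "cnode_of k (Inl x) = x"
| "cnode_of k (Inr (u, w)) = Copy k u w"

primrec corona_graph :: "'a sgraph \<Rightarrow> nat \<Rightarrow> 'a cnode sgraph" where
  "corona_graph G 0 = relabel Seed G"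
| "corona_graph G (Suc m) = relabel (cnode_of (Suc m)) (corona (corona_graph G m) G)"

lemma nodes_corona_graph_Suc:
  "nodes (corona_graph G (Suc m)) =
     nodes (corona_graph G m) \<union>
     {Copy (Suc m) u w | u w. u \<in> nodes (corona_graph G m) \<and> w \<in> nodes G}"
proof -
  have "cnode_of (Suc m) ` Inl ` X = X" for X :: "'a cnode set"
    by (simp add: image_image)
  moreover have "cnode_of (Suc m) ` {Inr (u, w) | u w. P u w} = {Copy (Suc m) u w | u w. P u w}"
    for P :: "'a cnode \<Rightarrow> 'a \<Rightarrow> bool"
    by force
  ultimately show ?thesis
    by (simp add: relabel_def corona_def image_Un)
qed

lemma Copy_in_corona_graph:
  "Copy k u w \<in> nodes (corona_graph G m) \<Longrightarrow> 1 \<le> k \<and> k \<le> m"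
proof (induction m)
  case 0
  then show ?case by (auto simp: relabel_def)
next
  case (Suc m)
  then show ?case unfolding nodes_corona_graph_Suc by auto
qed

text \<open>The renaming used in \<^const>\<open>corona_graph\<close> is injective, so each step yields an isomorphic image
  of the corona product.\<close>

lemma inj_on_cnode_of:
  "inj_on (cnode_of (Suc m)) (nodes (corona (corona_graph G m) G))"
  by (rule inj_onI) (auto simp: corona_def dest!: Copy_in_corona_graph)

lemma nodes_corona_graph_mono:
  assumes "i \<le> m"
  shows "nodes (corona_graph G i) \<subseteq> nodes (corona_graph G m)"
  using assms
proof (induction m rule: dec_induct)
  case base
  then show ?case by simp
next
  case (step m)
  then show ?case unfolding nodes_corona_graph_Suc by blast
qed

end

theory Submission imports Defs begin

text \<open>A step of the corona construction gives a node marked \<open>+\<close> exactly \<open>n\<^sub>+\<close> positive and \<open>n\<^sub>-\<close>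
  negative new edges, and a node marked \<open>-\<close> the other way round. The mark of a node is the parity of
  its negative degree, so the pair of degrees evolves autonomously. The new node \<open>v\<close> starts with the
  mark of \<open>u\<close>, since the joining edge contributes \<open>\<mu>(u) \<mu>\<^sub>0(v)\<close> to its mark \<open>\<mu>\<^sub>0(v)\<close> in the seed
  graph. The four cases are the four possible dynamics of the mark: alternating, absorbed at \<open>-\<close>,
  constant, absorbed at \<open>+\<close>.\<close>

section \<open>Degrees and marks in a signed graph\<close>

text \<open>The sign is a parameter so that each edge count below is proved once and serves for both
  the positive and the negative degree.\<close>

definition sign_edges :: "'v sgraph \<Rightarrow> int \<Rightarrow> 'v \<Rightarrow> 'v set set" where
  "sign_edges H s v = {e \<in> edges H. v \<in> e \<and> sgn_of H e = s}"

lemma pos_degree_eq: "pos_degree H v = card (sign_edges H 1 v)"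
  and neg_degree_eq: "neg_degree H v = card (sign_edges H (-1) v)"
  by (simp_all add: pos_degree_def neg_degree_def sign_edges_def)

lemma signed_graph_edgeD:
  assumes "signed_graph H" "e \<in> edges H"
  shows "e \<subseteq> nodes H" "e \<noteq> {}" "card e = 2" "sgn_of H e = 1 \<or> sgn_of H e = -1"
proof -
  show "card e = 2" "e \<subseteq> nodes H" "sgn_of H e = 1 \<or> sgn_of H e = -1"
    using assms by (auto simp: signed_graph_def)
  then show "e \<noteq> {}" by auto
qed

lemma finite_edges:
  assumes "signed_graph H"
  shows "finite (edges H)"
proof (rule finite_subset)
  show "edges H \<subseteq> Pow (nodes H)" using signed_graph_edgeD(1)[OF assms] by auto
  show "finite (Pow (nodes H))" using assms by (simp add: signed_graph_def)
qed

lemma finite_sign_edges: "signed_graph H \<Longrightarrow> finite (sign_edges H s v)"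
  by (simp add: sign_edges_def finite_edges)

text \<open>Only the signs 1 and -1 occur, so the product splits over two disjoint finite sets of
  edges and the positive part contributes 1. This turns every question about marks into one about
  the parity of a degree.\<close>

lemma marking_eq_power:
  assumes "signed_graph H"
  shows "marking H v = (-1) ^ neg_degree H v"
proof -
  have "{e \<in> edges H. v \<in> e} = sign_edges H 1 v \<union> sign_edges H (-1) v"
    using signed_graph_edgeD(4)[OF assms] by (auto simp: sign_edges_def)
  moreover have "sign_edges H 1 v \<inter> sign_edges H (-1) v = {}"
    by (auto simp: sign_edges_def)
  ultimately have "marking H v =
      (\<Prod>e \<in> sign_edges H 1 v. sgn_of H e) * (\<Prod>e \<in> sign_edges H (-1) v. sgn_of H e)"
    by (simp add: marking_def prod.union_disjoint finite_sign_edges[OF assms])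
  moreover have "(\<Prod>e \<in> sign_edges H s v. sgn_of H e) = s ^ card (sign_edges H s v)" for s
    by (simp add: sign_edges_def)
  ultimately show ?thesis by (simp add: neg_degree_eq)
qed

lemma marking_cases:
  assumes "signed_graph H"
  shows "marking H v = 1 \<or> marking H v = -1"
  unfolding marking_eq_power[OF assms] by (cases "even (neg_degree H v)") auto

lemma marking_eq_1_iff: "signed_graph H \<Longrightarrow> marking H v = 1 \<longleftrightarrow> even (neg_degree H v)"
  by (cases "even (neg_degree H v)") (auto simp: marking_eq_power)

section \<open>Invariance under renaming\<close>

lemma signed_graph_relabel:
  assumes "inj_on f (nodes H)" "signed_graph H"
  shows "signed_graph (relabel f H)"
  unfolding signed_graph_def
proof (intro conjI ballI)
  show "finite (nodes (relabel f H))"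
    using assms(2) by (simp add: relabel_def signed_graph_def)
next
  fix e' assume "e' \<in> edges (relabel f H)"
  then obtain e where e: "e \<in> edges H" "e' = f ` e" by (auto simp: relabel_def)
  note D = signed_graph_edgeD[OF assms(2) e(1)]
  show "e' \<subseteq> nodes (relabel f H)" using D(1) e(2) by (auto simp: relabel_def)
  show "card e' = 2" using D(1,3) e(2) inj_on_subset[OF assms(1)] by (simp add: card_image)
  show "sgn_of (relabel f H) e' = 1 \<or> sgn_of (relabel f H) e' = -1"
    using D(4) sgn_of_relabel[OF assms(1) D(1)] e(2) by simp
qed

text \<open>Edges lie inside \<open>nodes H\<close>, where \<open>f\<close> is injective; hence
  taking images preserves incidence and sign and is itself injective on edges.\<close>

lemma card_sign_edges_relabel:
  assumes "inj_on f (nodes H)" "signed_graph H" "v \<in> nodes H"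
  shows "card (sign_edges (relabel f H) s (f v)) = card (sign_edges H s v)"
proof -
  note sub = signed_graph_edgeD(1)[OF assms(2)]
  have "f v \<in> f ` e \<longleftrightarrow> v \<in> e" if "e \<in> edges H" for e
    using inj_on_image_mem_iff[OF assms(1,3) sub[OF that]] .
  moreover have "edges (relabel f H) = (`) f ` edges H" by (simp add: relabel_def)
  \<comment> \<open>Moves the selection from the image edges back to the edges of \<open>H\<close>,
    where incidence and sign can be rewritten.\<close>
  moreover have "{e' \<in> (`) f ` E. P e'} = (`) f ` {e \<in> E. P (f ` e)}" for E P
    by blast
  ultimately have "sign_edges (relabel f H) s (f v) = (`) f ` sign_edges H s v"
    using sgn_of_relabel[OF assms(1) sub] by (simp add: sign_edges_def cong: conj_cong)
  moreover have "inj_on ((`) f) (sign_edges H s v)"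
    using sub by (intro inj_on_subset[OF inj_on_image_Pow[OF assms(1)]]) (auto simp: sign_edges_def)
  ultimately show ?thesis by (simp add: card_image)
qed

section \<open>Degrees in a corona product\<close>

lemma edges_corona_cases:
  assumes "e \<in> edges (corona H1 H2)"
  obtains (left) e1 where "e1 \<in> edges H1" "e = Inl ` e1"
    | (copy) u e2 where "u \<in> nodes H1" "e2 \<in> edges H2" "e = (\<lambda>w. Inr (u, w)) ` e2"
    | (join) u w where "u \<in> nodes H1" "w \<in> nodes H2" "e = {Inl u, Inr (u, w)}"
  using assms by (auto simp: corona_def)

lemma edges_coronaI:
  "e1 \<in> edges H1 \<Longrightarrow> Inl ` e1 \<in> edges (corona H1 H2)"
  "u \<in> nodes H1 \<Longrightarrow> e2 \<in> edges H2 \<Longrightarrow> (\<lambda>w. Inr (u, w)) ` e2 \<in> edges (corona H1 H2)"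
  "u \<in> nodes H1 \<Longrightarrow> w \<in> nodes H2 \<Longrightarrow> {Inl u, Inr (u, w)} \<in> edges (corona H1 H2)"
  by (auto simp: corona_def)

text \<open>The only signs not inherited are those of joining edges; they are products of two marks,
  and marks are 1 or -1.\<close>

lemma signed_graph_corona:
  assumes "signed_graph H1" "signed_graph H2"
  shows "signed_graph (corona H1 H2)"
  unfolding signed_graph_def
proof (intro conjI ballI)
  \<comment> \<open>As images of finite sets, the two parts are visibly finite.\<close>
  have "nodes (corona H1 H2) = Inl ` nodes H1 \<union> Inr ` (nodes H1 \<times> nodes H2)"
    by (auto simp: corona_def)
  then show "finite (nodes (corona H1 H2))"
    using assms by (simp add: signed_graph_def)
next
  fix e assume "e \<in> edges (corona H1 H2)"
  then have "e \<subseteq> nodes (corona H1 H2) \<and> card e = 2 \<and>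
    (sgn_of (corona H1 H2) e = 1 \<or> sgn_of (corona H1 H2) e = -1)"
  proof (cases rule: edges_corona_cases)
    case (left e1)
    note D = signed_graph_edgeD[OF assms(1) left(1)]
    from D left show ?thesis
      by (auto simp: sgn_of_corona_left card_image) (auto simp: corona_def)
  next
    case (copy u e2)
    note D = signed_graph_edgeD[OF assms(2) copy(2)]
    have "card e = 2" using D copy by (simp add: card_image inj_on_def)
    moreover have "e \<subseteq> nodes (corona H1 H2)" using D copy by (auto simp: corona_def)
    ultimately show ?thesis
      using D copy by (simp add: sgn_of_corona_copy)
  next
    case (join u w)
    then have "e \<subseteq> nodes (corona H1 H2)" "card e = 2" by (auto simp: corona_def)
    then show ?thesis
      using join marking_cases[OF assms(1), of u] marking_cases[OF assms(2), of w]
      by (auto simp: sgn_of_corona_join)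
  qed
  then show "e \<subseteq> nodes (corona H1 H2)" "card e = 2"
    "sgn_of (corona H1 H2) e = 1 \<or> sgn_of (corona H1 H2) e = -1"
    by blast+
qed

text \<open>Edges inside a copy contain no \<open>Inl\<close> node, so an edge at
  \<open>Inl u\<close> comes from \<open>H1\<close> or joins \<open>u\<close> to its own copy of
  \<open>H2\<close>. The two families are disjoint, since a joining edge contains an
  \<open>Inr\<close> node.\<close>

lemma card_sign_edges_corona_Inl:
  fixes H1 :: "'b sgraph" and H2 :: "'a sgraph"
  assumes "signed_graph H1" "signed_graph H2" "u \<in> nodes H1"
  shows "card (sign_edges (corona H1 H2) s (Inl u)) =
    card (sign_edges H1 s u) + card {w \<in> nodes H2. marking H1 u * marking H2 w = s}"
proof -
  let ?join = "\<lambda>w. {Inl u, Inr (u, w)}"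
  let ?A = "(`) Inl ` sign_edges H1 s u :: ('b + 'b \<times> 'a) set set"
  let ?B = "?join ` {w \<in> nodes H2. marking H1 u * marking H2 w = s}"
  have "sign_edges (corona H1 H2) s (Inl u) = ?A \<union> ?B"
  proof (rule set_eqI, rule iffI)
    fix e assume "e \<in> sign_edges (corona H1 H2) s (Inl u)"
    then have e: "e \<in> edges (corona H1 H2)" "Inl u \<in> e" "sgn_of (corona H1 H2) e = s"
      by (auto simp: sign_edges_def)
    from e(1) show "e \<in> ?A \<union> ?B"
      by (cases rule: edges_corona_cases)
        (use e in \<open>auto simp: sign_edges_def sgn_of_corona_left sgn_of_corona_join\<close>)
  next
    fix e assume "e \<in> ?A \<union> ?B"
    then show "e \<in> sign_edges (corona H1 H2) s (Inl u)"
      using assms(3)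
      by (auto simp: sign_edges_def sgn_of_corona_left sgn_of_corona_join intro: edges_coronaI)
  qed
  moreover have "?A \<inter> ?B = {}" by auto
  moreover have "finite ?A" "finite ?B"
    using assms by (auto simp: finite_sign_edges signed_graph_def)
  moreover have "card ?A = card (sign_edges H1 s u)"
    by (intro card_image) (simp add: inj_on_def inj_image_eq_iff)
  moreover have "card ?B = card {w \<in> nodes H2. marking H1 u * marking H2 w = s}"
    by (intro card_image) (auto simp: inj_on_def doubleton_eq_iff)
  ultimately show ?thesis by (simp add: card_Un_disjoint)
qed

text \<open>A node of a copy meets exactly one joining edge, which accounts for the 0-1
  term.\<close>

lemma card_sign_edges_corona_Inr:
  fixes H1 :: "'b sgraph" and H2 :: "'a sgraph"
  assumes "signed_graph H2" "u \<in> nodes H1" "w \<in> nodes H2"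
  shows "card (sign_edges (corona H1 H2) s (Inr (u, w))) =
    card (sign_edges H2 s w) + (if marking H1 u * marking H2 w = s then 1 else 0)"
proof -
  let ?copy = "\<lambda>w. Inr (u, w) :: 'b + 'b \<times> 'a"
  let ?A = "(`) ?copy ` sign_edges H2 s w"
  let ?B = "if marking H1 u * marking H2 w = s then {{Inl u, ?copy w}} else {}"
  \<comment> \<open>\<open>sgn_of_corona_copy\<close> asks for a nonempty edge: the empty set would
    be caught by the branch of \<open>sgn_of\<close> meant for edges of \<open>H1\<close>.\<close>
  note ne = signed_graph_edgeD(2)[OF assms(1)]
  have "sign_edges (corona H1 H2) s (Inr (u, w)) = ?A \<union> ?B"
  proof (rule set_eqI, rule iffI)
    fix e assume "e \<in> sign_edges (corona H1 H2) s (Inr (u, w))"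
    then have e: "e \<in> edges (corona H1 H2)" "Inr (u, w) \<in> e" "sgn_of (corona H1 H2) e = s"
      by (auto simp: sign_edges_def)
    from e(1) show "e \<in> ?A \<union> ?B"
      by (cases rule: edges_corona_cases)
        (use e ne in \<open>auto simp: sign_edges_def sgn_of_corona_copy sgn_of_corona_join\<close>)
  next
    fix e assume "e \<in> ?A \<union> ?B"
    then show "e \<in> sign_edges (corona H1 H2) s (Inr (u, w))"
      using assms(2,3) ne
      by (auto simp: sign_edges_def sgn_of_corona_copy sgn_of_corona_join
          intro: edges_coronaI split: if_splits)
  qed
  moreover have "?A \<inter> ?B = {}" by auto
  moreover have "finite ?A" "finite ?B" using assms(1) by (simp_all add: finite_sign_edges)
  moreover have "card ?A = card (sign_edges H2 s w)"
    by (intro card_image) (simp add: inj_on_def inj_image_eq_iff)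
  moreover have "card ?B = (if marking H1 u * marking H2 w = s then 1 else 0)"
    by simp
  ultimately show ?thesis by (simp add: card_Un_disjoint)
qed

section \<open>Degrees and marks in the generated graphs\<close>

lemma signed_graph_corona_graph: "signed_graph G \<Longrightarrow> signed_graph (corona_graph G m)"
proof (induction m)
  case 0
  then show ?case by (auto intro: signed_graph_relabel simp: inj_on_def)
next
  case (Suc m)
  then show ?case
    using signed_graph_relabel[OF inj_on_cnode_of signed_graph_corona] by simp
qed

lemma card_sign_edges_corona_graph_old:
  assumes "signed_graph G" "v \<in> nodes (corona_graph G m)"
  shows "card (sign_edges (corona_graph G (Suc m)) s v) =
    card (sign_edges (corona_graph G m) s v)
      + card {w \<in> nodes G. marking (corona_graph G m) v * marking G w = s}"
proof -
  note sg = signed_graph_corona_graph[OF assms(1), of m]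
  \<comment> \<open>An old node keeps its name, \<open>cnode_of (Suc m) (Inl v) = v\<close>, so the
    count at \<open>Inl v\<close> carries over through the injective renaming.\<close>
  have "Inl v \<in> nodes (corona (corona_graph G m) G)" using assms(2) by (simp add: corona_def)
  from card_sign_edges_relabel[OF inj_on_cnode_of signed_graph_corona[OF sg assms(1)] this]
  show ?thesis by (simp add: card_sign_edges_corona_Inl[OF sg assms])
qed

lemma card_sign_edges_corona_graph_new:
  assumes "signed_graph G" "u \<in> nodes (corona_graph G m)" "w \<in> nodes G"
  shows "card (sign_edges (corona_graph G (Suc m)) s (Copy (Suc m) u w)) =
    card (sign_edges G s w) + (if marking (corona_graph G m) u * marking G w = s then 1 else 0)"
proof -
  note sg = signed_graph_corona_graph[OF assms(1), of m]
  have "Inr (u, w) \<in> nodes (corona (corona_graph G m) G)"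
    using assms(2,3) by (simp add: corona_def)
  from card_sign_edges_relabel[OF inj_on_cnode_of signed_graph_corona[OF sg assms(1)] this]
  show ?thesis by (simp add: card_sign_edges_corona_Inr[OF assms])
qed

lemma degree_corona_graph_Suc:
  assumes "signed_graph G" "v \<in> nodes (corona_graph G m)"
    and "n\<^sub>p = card {x \<in> nodes G. marking G x = 1}"
    and "n\<^sub>n = card {x \<in> nodes G. marking G x = -1}"
  defines "b \<equiv> neg_degree (corona_graph G m) v"
  shows "pos_degree (corona_graph G (Suc m)) v =
      pos_degree (corona_graph G m) v + (if even b then n\<^sub>p else n\<^sub>n)"
    and "neg_degree (corona_graph G (Suc m)) v = b + (if even b then n\<^sub>n else n\<^sub>p)"
proof -
  have mark: "marking (corona_graph G m) v = (if even b then 1 else -1)"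
    unfolding b_def by (simp add: marking_eq_power signed_graph_corona_graph assms(1))
  \<comment> \<open>For \<open>v\<close> marked -1, the new positive edges go to the nodes with
    \<open>- marking G x = 1\<close>; this brings the condition to the form that defines
    \<open>n\<^sub>n\<close>.\<close>
  have flip: "- x = 1 \<longleftrightarrow> x = -1" for x :: int by auto
  show "pos_degree (corona_graph G (Suc m)) v =
      pos_degree (corona_graph G m) v + (if even b then n\<^sub>p else n\<^sub>n)"
    unfolding pos_degree_eq card_sign_edges_corona_graph_old[OF assms(1,2)] mark
    by (simp add: assms(3,4) flip)
  show "neg_degree (corona_graph G (Suc m)) v = b + (if even b then n\<^sub>n else n\<^sub>p)"
    unfolding neg_degree_eq card_sign_edges_corona_graph_old[OF assms(1,2)] mark
    by (simp add: assms(3,4) b_def neg_degree_eq)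
qed

text \<open>The mark of \<open>w\<close> occurs twice, once from its seed edges and once in the sign
  of the joining edge, and it squares to 1. In terms of parity, the joining edge raises the negative
  degree exactly when the two marks differ.\<close>

lemma marking_Copy:
  assumes "signed_graph G" "u \<in> nodes (corona_graph G m)" "w \<in> nodes G"
  shows "marking (corona_graph G (Suc m)) (Copy (Suc m) u w) = marking (corona_graph G m) u"
  using marking_cases[OF assms(1), of w]
    marking_cases[OF signed_graph_corona_graph[OF assms(1)], of m u]
    marking_eq_power[OF assms(1), of w]
  by (auto simp: marking_eq_power[OF signed_graph_corona_graph[OF assms(1)], of "Suc m"]
      neg_degree_eq card_sign_edges_corona_graph_new[OF assms] simp del: corona_graph.simps)

section \<open>Closed forms of the degree recurrence\<close>

text \<open>\<open>a k\<close> and \<open>b k\<close> stand for the positive and negative degree of a node \<open>k\<close> steps after it appeared.\<close>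

locale degree_recurrence =
  fixes a b :: "nat \<Rightarrow> nat" and p q :: nat
  assumes a_Suc: "a (Suc k) = a k + (if even (b k) then p else q)"
    and b_Suc: "b (Suc k) = b k + (if even (b k) then q else p)"
begin

text \<open>An even \<open>b\<close> grows by \<open>q\<close>, which is even, so the same branch is
  taken at every step. \<open>odd_stays\<close> is the mirror image.\<close>

lemma even_stays:
  assumes "even (b 0)" "even q"
  shows "a k = a 0 + k * p \<and> b k = b 0 + k * q"
  by (induction k) (use assms in \<open>auto simp: a_Suc b_Suc\<close>)

lemma odd_stays:
  assumes "odd (b 0)" "even p"
  shows "a k = a 0 + k * q \<and> b k = b 0 + k * p"
  by (induction k) (use assms in \<open>auto simp: a_Suc b_Suc\<close>)

text \<open>Restarts the recurrence one step later, for the cases in which the mark changes exactly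
  once, at the first step.\<close>

lemma shift: "degree_recurrence (\<lambda>k. a (Suc k)) (\<lambda>k. b (Suc k)) p q"
  by unfold_locales (simp_all only: a_Suc b_Suc)

text \<open>The first step adds the odd \<open>q\<close> and makes \<open>b\<close> odd; the
  remaining \<open>k - 1\<close> steps add the even \<open>p\<close> and keep it so.\<close>

lemma even_then_odd:
  assumes "even (b 0)" "odd q" "even p" "0 < k"
  shows "a k = a 0 + p + (k - 1) * q \<and> b k = b 0 + q + (k - 1) * p"
  using degree_recurrence.odd_stays[OF shift, of "k - 1"] assms by (simp add: a_Suc b_Suc)

lemma odd_then_even:
  assumes "odd (b 0)" "odd p" "even q" "0 < k"
  shows "a k = a 0 + q + (k - 1) * p \<and> b k = b 0 + p + (k - 1) * q"
  using degree_recurrence.even_stays[OF shift, of "k - 1"] assms by (simp add: a_Suc b_Suc)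

text \<open>With \<open>p\<close> and \<open>q\<close> odd, every step flips the parity of
  \<open>b\<close>. Two consecutive steps therefore use both branches once and add
  \<open>p + q\<close> to each degree, whatever the starting parity.\<close>

lemma alternating_even:
  assumes "odd p" "odd q" "even k"
  shows "a k = a 0 + (k div 2) * (p + q) \<and> b k = b 0 + (k div 2) * (p + q)"
proof -
  have "a (2 * j) = a 0 + j * (p + q) \<and> b (2 * j) = b 0 + j * (p + q)" for j
    by (induction j) (use assms in \<open>auto simp: a_Suc b_Suc\<close>)
  from this[of "k div 2"] show ?thesis using assms(3) by simp
qed

lemma alternating_odd:
  assumes "odd p" "odd q" "odd k"
  shows "a k = a 0 + (if even (b 0) then ((k + 1) div 2) * p + ((k - 1) div 2) * q
      else ((k + 1) div 2) * q + ((k - 1) div 2) * p)"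
    and "b k = b 0 + (if even (b 0) then ((k + 1) div 2) * q + ((k - 1) div 2) * p
      else ((k + 1) div 2) * p + ((k - 1) div 2) * q)"
proof -
  \<comment> \<open>After \<open>2 * j\<close> steps \<open>b\<close> has regained the parity of
    \<open>b 0\<close>, as \<open>p + q\<close> is even, so \<open>b 0\<close> decides the last
    step. Here \<open>(k + 1) div 2 = j + 1\<close> and \<open>(k - 1) div 2 = j\<close>.\<close>
  obtain j where k: "k = Suc (2 * j)" using assms(3) by (auto elim: oddE)
  have *: "a (2 * j) = a 0 + j * (p + q)" "b (2 * j) = b 0 + j * (p + q)"
    using alternating_even[of "2 * j"] assms by auto
  show "a k = a 0 + (if even (b 0) then ((k + 1) div 2) * p + ((k - 1) div 2) * q
      else ((k + 1) div 2) * q + ((k - 1) div 2) * p)"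
    and "b k = b 0 + (if even (b 0) then ((k + 1) div 2) * q + ((k - 1) div 2) * p
      else ((k + 1) div 2) * p + ((k - 1) div 2) * q)"
    using assms(1,2) unfolding k by (simp_all add: a_Suc b_Suc * distrib_left)
qed

end

theorem theorem6:
  fixes G :: "'a sgraph" and u v :: "'a cnode" and w :: 'a
    and m i n n\<^sub>p n\<^sub>n d\<^sub>p d\<^sub>n p\<^sub>0 q\<^sub>0 :: nat and \<mu>\<^sub>u \<mu>\<^sub>0 :: int
  assumes "signed_graph G"
    and "n\<^sub>p = card {x \<in> nodes G. marking G x = 1}"
    and "n\<^sub>n = card {x \<in> nodes G. marking G x = -1}"
    and "n = n\<^sub>p + n\<^sub>n"
    and "1 \<le> i" and "i \<le> m"
    and "u \<in> nodes (corona_graph G (i - 1))" and "w \<in> nodes G" and "v = Copy i u w"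
    and "p\<^sub>0 = pos_degree G w" and "q\<^sub>0 = neg_degree G w"
    and "\<mu>\<^sub>0 = marking G w" and "\<mu>\<^sub>u = marking (corona_graph G (i - 1)) u"
    and "d\<^sub>p = pos_degree (corona_graph G m) v" and "d\<^sub>n = neg_degree (corona_graph G m) v"
  shows
    "(odd n\<^sub>p \<and> odd n\<^sub>n \<longrightarrow>
        ((even m \<longleftrightarrow> even i) \<longrightarrow>
          ((\<mu>\<^sub>u, \<mu>\<^sub>0) = (1, 1) \<or> (\<mu>\<^sub>u, \<mu>\<^sub>0) = (-1, -1) \<longrightarrow>
             d\<^sub>p = p\<^sub>0 + 1 + ((m - i) div 2) * n \<and>
             d\<^sub>n = q\<^sub>0 + ((m - i) div 2) * n) \<and>
          ((\<mu>\<^sub>u, \<mu>\<^sub>0) = (1, -1) \<or> (\<mu>\<^sub>u, \<mu>\<^sub>0) = (-1, 1) \<longrightarrow>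
             d\<^sub>p = p\<^sub>0 + ((m - i) div 2) * n \<and>
             d\<^sub>n = q\<^sub>0 + 1 + ((m - i) div 2) * n)) \<and>
        (\<not> (even m \<longleftrightarrow> even i) \<longrightarrow>
          ((\<mu>\<^sub>u, \<mu>\<^sub>0) = (1, 1) \<longrightarrow>
             d\<^sub>p = p\<^sub>0 + 1 + ((m - i + 1) div 2) * n\<^sub>p + ((m - i - 1) div 2) * n\<^sub>n \<and>
             d\<^sub>n = q\<^sub>0 + ((m - i + 1) div 2) * n\<^sub>n + ((m - i - 1) div 2) * n\<^sub>p) \<and>
          ((\<mu>\<^sub>u, \<mu>\<^sub>0) = (1, -1) \<longrightarrow>
             d\<^sub>p = p\<^sub>0 + ((m - i + 1) div 2) * n\<^sub>p + ((m - i - 1) div 2) * n\<^sub>n \<and>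
             d\<^sub>n = q\<^sub>0 + 1 + ((m - i + 1) div 2) * n\<^sub>n + ((m - i - 1) div 2) * n\<^sub>p) \<and>
          ((\<mu>\<^sub>u, \<mu>\<^sub>0) = (-1, 1) \<longrightarrow>
             d\<^sub>p = p\<^sub>0 + ((m - i + 1) div 2) * n\<^sub>n + ((m - i - 1) div 2) * n\<^sub>p \<and>
             d\<^sub>n = q\<^sub>0 + 1 + ((m - i + 1) div 2) * n\<^sub>p + ((m - i - 1) div 2) * n\<^sub>n) \<and>
          ((\<mu>\<^sub>u, \<mu>\<^sub>0) = (-1, -1) \<longrightarrow>
             d\<^sub>p = p\<^sub>0 + 1 + ((m - i + 1) div 2) * n\<^sub>n + ((m - i - 1) div 2) * n\<^sub>p \<and>
             d\<^sub>n = q\<^sub>0 + ((m - i + 1) div 2) * n\<^sub>p + ((m - i - 1) div 2) * n\<^sub>n))) \<and>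
     (even n\<^sub>p \<and> odd n\<^sub>n \<longrightarrow>
        ((\<mu>\<^sub>u, \<mu>\<^sub>0) = (1, 1) \<longrightarrow>
           (m > i \<longrightarrow> d\<^sub>p = p\<^sub>0 + 1 + n\<^sub>p + (m - i - 1) * n\<^sub>n \<and> d\<^sub>n = q\<^sub>0 + n\<^sub>n + (m - i - 1) * n\<^sub>p) \<and>
           (m = i \<longrightarrow> d\<^sub>p = p\<^sub>0 + 1 \<and> d\<^sub>n = q\<^sub>0)) \<and>
        ((\<mu>\<^sub>u, \<mu>\<^sub>0) = (1, -1) \<longrightarrow>
           (m > i \<longrightarrow> d\<^sub>p = p\<^sub>0 + n\<^sub>p + (m - i - 1) * n\<^sub>n \<and> d\<^sub>n = q\<^sub>0 + 1 + n\<^sub>n + (m - i - 1) * n\<^sub>p) \<and>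
           (m = i \<longrightarrow> d\<^sub>p = p\<^sub>0 \<and> d\<^sub>n = q\<^sub>0 + 1)) \<and>
        ((\<mu>\<^sub>u, \<mu>\<^sub>0) = (-1, 1) \<longrightarrow>
           d\<^sub>p = p\<^sub>0 + (m - i) * n\<^sub>n \<and> d\<^sub>n = q\<^sub>0 + 1 + (m - i) * n\<^sub>p) \<and>
        ((\<mu>\<^sub>u, \<mu>\<^sub>0) = (-1, -1) \<longrightarrow>
           d\<^sub>p = p\<^sub>0 + 1 + (m - i) * n\<^sub>n \<and> d\<^sub>n = q\<^sub>0 + (m - i) * n\<^sub>p)) \<and>
     (even n\<^sub>p \<and> even n\<^sub>n \<longrightarrow>
        ((\<mu>\<^sub>u, \<mu>\<^sub>0) = (1, 1) \<longrightarrow>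
           d\<^sub>p = p\<^sub>0 + 1 + (m - i) * n\<^sub>p \<and> d\<^sub>n = q\<^sub>0 + (m - i) * n\<^sub>n) \<and>
        ((\<mu>\<^sub>u, \<mu>\<^sub>0) = (1, -1) \<longrightarrow>
           d\<^sub>p = p\<^sub>0 + (m - i) * n\<^sub>p \<and> d\<^sub>n = q\<^sub>0 + 1 + (m - i) * n\<^sub>n) \<and>
        ((\<mu>\<^sub>u, \<mu>\<^sub>0) = (-1, 1) \<longrightarrow>
           d\<^sub>p = p\<^sub>0 + (m - i) * n\<^sub>n \<and> d\<^sub>n = q\<^sub>0 + 1 + (m - i) * n\<^sub>p) \<and>
        ((\<mu>\<^sub>u, \<mu>\<^sub>0) = (-1, -1) \<longrightarrow>
           d\<^sub>p = p\<^sub>0 + 1 + (m - i) * n\<^sub>n \<and> d\<^sub>n = q\<^sub>0 + (m - i) * n\<^sub>p)) \<and>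
     (odd n\<^sub>p \<and> even n\<^sub>n \<longrightarrow>
        ((\<mu>\<^sub>u, \<mu>\<^sub>0) = (1, 1) \<longrightarrow>
           d\<^sub>p = p\<^sub>0 + 1 + (m - i) * n\<^sub>p \<and> d\<^sub>n = q\<^sub>0 + (m - i) * n\<^sub>n) \<and>
        ((\<mu>\<^sub>u, \<mu>\<^sub>0) = (1, -1) \<longrightarrow>
           d\<^sub>p = p\<^sub>0 + (m - i) * n\<^sub>p \<and> d\<^sub>n = q\<^sub>0 + 1 + (m - i) * n\<^sub>n) \<and>
        ((\<mu>\<^sub>u, \<mu>\<^sub>0) = (-1, 1) \<longrightarrow>
           (m > i \<longrightarrow> d\<^sub>p = p\<^sub>0 + n\<^sub>n + (m - i - 1) * n\<^sub>p \<and> d\<^sub>n = q\<^sub>0 + 1 + n\<^sub>p + (m - i - 1) * n\<^sub>n) \<and>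
           (m = i \<longrightarrow> d\<^sub>p = p\<^sub>0 \<and> d\<^sub>n = q\<^sub>0 + 1)) \<and>
        ((\<mu>\<^sub>u, \<mu>\<^sub>0) = (-1, -1) \<longrightarrow>
           (m > i \<longrightarrow> d\<^sub>p = p\<^sub>0 + 1 + n\<^sub>n + (m - i - 1) * n\<^sub>p \<and> d\<^sub>n = q\<^sub>0 + n\<^sub>p + (m - i - 1) * n\<^sub>n) \<and>
           (m = i \<longrightarrow> d\<^sub>p = p\<^sub>0 + 1 \<and> d\<^sub>n = q\<^sub>0)))"
proof -
  \<comment> \<open>Time is counted from the appearance of \<open>v\<close> at step
    \<open>i\<close>, so index 0 already includes the edge joining \<open>v\<close> to
    \<open>u\<close>.\<close>
  define k where "k = m - i"
  define a where "a j = pos_degree (corona_graph G (i + j)) v" for j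
  define b where "b j = neg_degree (corona_graph G (i + j)) v" for j
  obtain i' where i': "i = Suc i'" using assms(5) by (cases i) auto
  have u: "u \<in> nodes (corona_graph G i')" and \<mu>u: "\<mu>\<^sub>u = marking (corona_graph G i') u"
    using assms(7,13) i' by simp_all
  have "v \<in> nodes (corona_graph G i)"
    unfolding i' nodes_corona_graph_Suc using u assms(8,9) i' by auto
  then have v: "v \<in> nodes (corona_graph G (i + j))" for j
    using nodes_corona_graph_mono[of i "i + j"] by auto
  interpret degree_recurrence a b n\<^sub>p n\<^sub>n
    by unfold_locales
      (simp_all add: a_def b_def degree_corona_graph_Suc[OF assms(1) v assms(2,3)]
        del: corona_graph.simps)
  \<comment> \<open>The initial parity is governed by the mark of \<open>u\<close> alone, because
    \<open>v\<close> starts with that mark.\<close>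
  have even_b0: "even (b 0) \<longleftrightarrow> \<mu>\<^sub>u = 1"
    using marking_Copy[OF assms(1) u assms(8)]
      marking_eq_1_iff[OF signed_graph_corona_graph[OF assms(1)], of i v]
    by (simp add: b_def i' assms(9) \<mu>u del: corona_graph.simps)
  \<comment> \<open>The joining edge has sign \<open>\<mu>\<^sub>u * \<mu>\<^sub>0\<close>; it is
    the source of the \<open>+ 1\<close> in every formula.\<close>
  have a0: "a 0 = p\<^sub>0 + (if \<mu>\<^sub>u * \<mu>\<^sub>0 = 1 then 1 else 0)"
    and b0: "b 0 = q\<^sub>0 + (if \<mu>\<^sub>u * \<mu>\<^sub>0 = -1 then 1 else 0)"
    by (simp_all add: a_def b_def i' assms(9-12) \<mu>u pos_degree_eq neg_degree_eq
        card_sign_edges_corona_graph_new[OF assms(1) u assms(8)] del: corona_graph.simps)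
  have dp: "d\<^sub>p = a k" and dn: "d\<^sub>n = b k"
    using assms(6,14,15) by (simp_all add: a_def b_def k_def)
  \<comment> \<open>\<open>i \<le> m\<close> matters here: the subtraction in \<open>k\<close> is
    then not truncated.\<close>
  have parity: "(even m \<longleftrightarrow> even i) \<longleftrightarrow> even k" and cmp: "i < m \<longleftrightarrow> 0 < k" "m = i \<longleftrightarrow> k = 0"
    using assms(6) by (auto simp: k_def)
  have \<mu>: "\<mu>\<^sub>u = 1 \<or> \<mu>\<^sub>u = -1" "\<mu>\<^sub>0 = 1 \<or> \<mu>\<^sub>0 = -1"
    using marking_cases[OF assms(1)] marking_cases[OF signed_graph_corona_graph[OF assms(1)]]
    by (simp_all add: assms(12) \<mu>u)
  note start = even_b0 a0 b0
  \<comment> \<open>Restates the goal in terms of \<open>k\<close>, \<open>a\<close> and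
    \<open>b\<close>.\<close>
  note in_k = parity cmp dp dn k_def[symmetric] assms(4)
  consider "even n\<^sub>p" "even n\<^sub>n" | "even n\<^sub>p" "odd n\<^sub>n" | "odd n\<^sub>p" "even n\<^sub>n" | "odd n\<^sub>p" "odd n\<^sub>n"
    by blast
  then show ?thesis
  proof cases
    case 1
    with \<mu> show ?thesis unfolding in_k
      by (elim disjE) (use start even_stays[of k] odd_stays[of k] in simp_all)
  next
    case 2
    with \<mu> show ?thesis unfolding in_k
      \<comment> \<open>\<open>even_then_odd\<close> requires \<open>0 < k\<close>; the branch
        \<open>m = i\<close> is read off from \<open>a0\<close> and \<open>b0\<close>.\<close>
      by (elim disjE) (use start even_then_odd[of k] odd_stays[of k] in simp_all)
  next
    case 3
    with \<mu> show ?thesis unfolding in_k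
      by (elim disjE) (use start even_stays[of k] odd_then_even[of k] in simp_all)
  next
    case 4
    with \<mu> show ?thesis unfolding in_k
      by (elim disjE) (use start alternating_even[of k] alternating_odd[of k] in simp_all)
  qed
qed

end
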